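(* Let $U$ be a subset of $F^1_{USCG}(X)$. Then the following are equivalent: (i) $U$ is compact in $(F^1_{USCG}(X), H_{\rm end})$; (ii) $U(\alpha)$ is relatively compact in $(X,d)$ for each $\alpha\in(0,1]$ and $U$ is closed in $(F^1_{USCG}(X), H_{\rm end})$; (iii) $U(\alpha)$ is compact in $(X,d)$ for each $\alpha\in(0,1]$ and $U$ is closed in $(F^1_{USCG}(X), H_{\rm end})$.
   Context: $(X,d)$ is a nonempty metric space. $X\times[0,1]$ carries the metric $\overline d((x,\alpha),(y,\beta))=d(x,y)+|\alpha-\beta|$. A fuzzy set in $X$ is a function $u:X\to[0,1]$. Its $\alpha$-cuts are $[u]_\alpha=\{x\in X: u(x)\ge\alpha\}$ for $\alpha\in(0,1]$ and $[u]_0=\overline{\{x\in X:u(x)>0\}}$ (closure in $X$). $C(Y)$ and $K(Y)$ denote the sets of nonempty closed, respectively nonempty compact, subsets of a metric space $Y$. $F^1_{USC}(X)$ is the set of fuzzy sets $u$ in $X$ with $[u]_\alpha\in C(X)$ for all $\alpha\in[0,1]$; $F^1_{USCG}(X)$ is the set of $u\in F^1_{USC}(X)$ with $[u]_\alpha\in K(X)$ for all $\alpha\in(0,1]$. For nonempty closed sets $A,B$, $H^*(A,B)=\sup_{a\in A}\inf_{b\in B}\rho(a,b)$ and $H(A,B)=\max\{H^*(A,B),H^*(B,A)\}$ is the Hausdorff distance, where $\rho$ is the underlying metric ($d$ on $X$, $\overline d$ on $X\times[0,1]$). The endograph is ${\rm end}\,u=\{(x,t)\in X\times[0,1]:u(x)\ge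 t\}$, and $H_{\rm end}(u,v)=H({\rm end}\,u,{\rm end}\,v)$ (computed with $\overline d$), which is a metric on $F^1_{USC}(X)$. For a set $U$ of fuzzy sets, $U(\alpha)=\bigcup_{u\in U}[u]_\alpha$. A subset of a metric space is relatively compact if its closure in that space is compact. *)

theory Defs
  imports "HOL-Analysis.Analysis"
begin

definition fuzzy_sets :: "('a \<Rightarrow> real) set" where
  "fuzzy_sets = {u. \<forall>x. u x \<in> {0..1}}"

definition alpha_cut :: "('a::metric_space \<Rightarrow> real) \<Rightarrow> real \<Rightarrow> 'a set" where
  "alpha_cut u \<alpha> = (if \<alpha> = 0 then closure {x. u x > 0} else {x. u x \<ge> \<alpha>})"

definition F1_USC :: "('a::metric_space \<Rightarrow> real) set" where
  "F1_USC = {u \<in> fuzzy_sets. \<forall>\<alpha>\<in>{0..1}. closed (alpha_cut u \<alpha>) \<and> alpha_cut u \<alpha> \<noteq> {}}"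

definition F1_USCG :: "('a::metric_space \<Rightarrow> real) set" where
  "F1_USCG = {u \<in> F1_USC. \<forall>\<alpha>\<in>{0<..1}. compact (alpha_cut u \<alpha>) \<and> alpha_cut u \<alpha> \<noteq> {}}"

(* The metric on X x [0,1] is the sum metric, not the library's (Euclidean) product metric. *)
definition dbar :: "'a::metric_space \<times> real \<Rightarrow> 'a \<times> real \<Rightarrow> real" where
  "dbar p q = dist (fst p) (fst q) + \<bar>snd p - snd q\<bar>"

(* Extended-real valued, since the Hausdorff distance of unbounded sets may be infinite. *)
definition hausdorff_semidist :: "('b \<Rightarrow> 'b \<Rightarrow> real) \<Rightarrow> 'b set \<Rightarrow> 'b set \<Rightarrow> ereal" where
  "hausdorff_semidist \<rho> A B = (SUP a\<in>A. INF b\<in>B. ereal (\<rho> a b))"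

definition hausdorff_distance :: "('b \<Rightarrow> 'b \<Rightarrow> real) \<Rightarrow> 'b set \<Rightarrow> 'b set \<Rightarrow> ereal" where
  "hausdorff_distance \<rho> A B = max (hausdorff_semidist \<rho> A B) (hausdorff_semidist \<rho> B A)"

definition endograph :: "('a \<Rightarrow> real) \<Rightarrow> ('a \<times> real) set" where
  "endograph u = {(x, t). t \<in> {0..1} \<and> u x \<ge> t}"

(* The distance of endographs of fuzzy sets is finite (at most 1), see Hend_le below,
   so the conversion to a real number loses nothing. *)
definition Hend :: "('a::metric_space \<Rightarrow> real) \<Rightarrow> ('a \<Rightarrow> real) \<Rightarrow> real" where
  "Hend u v = real_of_ereal (hausdorff_distance dbar (endograph u) (endograph v))"

definition level_union :: "('a::metric_space \<Rightarrow> real) set \<Rightarrow> real \<Rightarrow> 'a set" where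
  "level_union U \<alpha> = (\<Union>u\<in>U. alpha_cut u \<alpha>)"

definition relatively_compact :: "'a::metric_space set \<Rightarrow> bool" where
  "relatively_compact A \<longleftrightarrow> compact (closure A)"

lemma dbar_nonneg: "dbar p q \<ge> 0"
  by (simp add: dbar_def)

lemma dbar_commute: "dbar p q = dbar q p"
  by (simp add: dbar_def dist_commute abs_minus_commute)

lemma dbar_triangle: "dbar p r \<le> dbar p q + dbar q r"
proof -
  have "dist (fst p) (fst r) \<le> dist (fst p) (fst q) + dist (fst q) (fst r)"
    by (rule dist_triangle)
  then show ?thesis by (simp add: dbar_def)
qed

lemma hausdorff_semidist_le_iff:
  "hausdorff_semidist \<rho> A B \<le> ereal r \<longleftrightarrow> (\<forall>a\<in>A. \<forall>e>0. \<exists>b\<in>B. \<rho> a b < r + e)"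
proof -
  have "(INF b\<in>B. ereal (\<rho> a b)) \<le> ereal r \<longleftrightarrow> (\<forall>e>0. \<exists>b\<in>B. \<rho> a b < r + e)" for a
  proof
    assume le: "(INF b\<in>B. ereal (\<rho> a b)) \<le> ereal r"
    show "\<forall>e>0. \<exists>b\<in>B. \<rho> a b < r + e"
    proof (intro allI impI)
      fix e :: real assume "e > 0"
      then have "ereal r < ereal (r + e)" by simp
      with le have "(INF b\<in>B. ereal (\<rho> a b)) < ereal (r + e)" by (rule le_less_trans)
      then show "\<exists>b\<in>B. \<rho> a b < r + e" by (auto simp: INF_less_iff)
    qed
  next
    assume R: "\<forall>e>0. \<exists>b\<in>B. \<rho> a b < r + e"
    show "(INF b\<in>B. ereal (\<rho> a b)) \<le> ereal r"
    proof (rule ereal_le_epsilon2)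
      fix e :: real assume "0 < e"
      with R obtain b where "b \<in> B" "\<rho> a b < r + e" by blast
      then show "(INF b\<in>B. ereal (\<rho> a b)) \<le> ereal r + ereal e"
        by (intro INF_lower2[of b]) auto
    qed
  qed
  then show ?thesis by (simp add: hausdorff_semidist_def SUP_le_iff)
qed

lemma semidist_endograph_le:
  assumes "u \<in> fuzzy_sets" "v \<in> fuzzy_sets"
  shows "hausdorff_semidist dbar (endograph u) (endograph v) \<le> ereal 1"
  unfolding hausdorff_semidist_le_iff
proof (intro ballI allI impI)
  fix a e assume "a \<in> endograph u" "(e::real) > 0"
  with assms show "\<exists>b\<in>endograph v. dbar a b < 1 + e"
    by (intro bexI[of _ "(fst a, 0)"]) (auto simp: endograph_def dbar_def fuzzy_sets_def)
qed

lemma semidist_nonneg: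
  assumes "A \<noteq> {}"
  shows "0 \<le> hausdorff_semidist dbar A B"
proof -
  obtain a where "a \<in> A" using assms by blast
  then show ?thesis unfolding hausdorff_semidist_def
    by (rule SUP_upper2) (auto intro!: INF_greatest simp: dbar_nonneg)
qed

lemma semidist_endograph_nonneg:
  assumes "u \<in> fuzzy_sets"
  shows "0 \<le> hausdorff_semidist dbar (endograph u) B"
proof -
  have "(undefined, 0) \<in> endograph u" using assms by (auto simp: endograph_def fuzzy_sets_def)
  then show ?thesis by (intro semidist_nonneg) auto
qed

lemma ereal_Hend:
  assumes "u \<in> fuzzy_sets" "v \<in> fuzzy_sets"
  shows "ereal (Hend u v) = hausdorff_distance dbar (endograph u) (endograph v)"
proof -
  let ?h = "hausdorff_distance dbar (endograph u) (endograph v)"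
  have "0 \<le> ?h" "?h \<le> 1"
    using semidist_endograph_le[OF assms] semidist_endograph_le[OF assms(2,1)]
      semidist_endograph_nonneg[OF assms(1)]
    by (auto simp: hausdorff_distance_def one_ereal_def intro: max.coboundedI1)
  then show ?thesis unfolding Hend_def by (cases ?h) auto
qed

lemma Hend_le_iff:
  assumes "u \<in> fuzzy_sets" "v \<in> fuzzy_sets"
  shows "Hend u v \<le> r \<longleftrightarrow>
    (\<forall>a\<in>endograph u. \<forall>e>0. \<exists>b\<in>endograph v. dbar a b < r + e) \<and>
    (\<forall>a\<in>endograph v. \<forall>e>0. \<exists>b\<in>endograph u. dbar a b < r + e)"
proof -
  have "Hend u v \<le> r \<longleftrightarrow> ereal (Hend u v) \<le> ereal r" by simp
  then show ?thesis
    by (simp only: ereal_Hend[OF assms] hausdorff_distance_def max.bounded_iff hausdorff_semidist_le_iff)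
qed

lemma Hend_le:
  assumes "u \<in> fuzzy_sets" "v \<in> fuzzy_sets"
  shows "Hend u v \<le> 1"
  using semidist_endograph_le[OF assms] semidist_endograph_le[OF assms(2,1)]
  by (simp only: Hend_le_iff[OF assms] hausdorff_semidist_le_iff)

lemma Hend_nonneg: "0 \<le> Hend u v"
proof (cases "endograph u = {} \<and> endograph v = {}")
  case True
  then show ?thesis by (simp add: Hend_def hausdorff_distance_def hausdorff_semidist_def bot_ereal_def)
next
  case False
  then have "0 \<le> hausdorff_distance dbar (endograph u) (endograph v)"
    using semidist_nonneg[of "endograph u" "endograph v"] semidist_nonneg[of "endograph v" "endograph u"]
    unfolding hausdorff_distance_def le_max_iff_disj by blast
  then show ?thesis unfolding Hend_def by (rule real_of_ereal_pos)
qed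

lemma Hend_commute: "Hend u v = Hend v u"
  by (simp add: Hend_def hausdorff_distance_def max.commute)

lemma Hend_triangle:
  assumes "u \<in> fuzzy_sets" "v \<in> fuzzy_sets" "w \<in> fuzzy_sets"
  shows "Hend u w \<le> Hend u v + Hend v w"
proof -
  have *: "\<exists>c\<in>C. dbar a c < r + s + e"
    if hyps: "\<forall>a\<in>A. \<forall>e>0. \<exists>b\<in>B. dbar a b < r + e" "\<forall>b\<in>B. \<forall>e>0. \<exists>c\<in>C. dbar b c < s + e"
      "a \<in> A" "e > 0" for A B C :: "('a \<times> real) set" and a r s e
  proof -
    have "e/2 > 0" using hyps by simp
    obtain b where b: "b \<in> B" "dbar a b < r + e/2" using hyps \<open>e/2 > 0\<close> by blast
    obtain c where c: "c \<in> C" "dbar b c < s + e/2" using hyps b \<open>e/2 > 0\<close> by blast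
    have "dbar a c < r + s + e" using dbar_triangle[of a c b] b c by simp
    then show ?thesis using c by blast
  qed
  have 1: "Hend u v \<le> Hend u v" "Hend v w \<le> Hend v w" by simp_all
  note h = 1[unfolded Hend_le_iff[OF assms(1,2)] Hend_le_iff[OF assms(2,3)]]
  show ?thesis unfolding Hend_le_iff[OF assms(1,3)]
    using *[OF h(1)[THEN conjunct1] h(2)[THEN conjunct1]]
      *[OF h(2)[THEN conjunct2] h(1)[THEN conjunct2]]
    by (simp add: add.commute)
qed

lemma Hend_zero_le:
  assumes u: "u \<in> F1_USC" and v: "v \<in> F1_USC" and 0: "Hend u v = 0"
  shows "u x \<le> v x"
proof (rule dense_le)
  fix \<alpha> assume less: "\<alpha> < u x"
  have fz: "u \<in> fuzzy_sets" "v \<in> fuzzy_sets" using u v by (auto simp: F1_USC_def)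
  have ux: "0 \<le> u x" "u x \<le> 1" "0 \<le> v x" using fz by (auto simp: fuzzy_sets_def)
  show "\<alpha> \<le> v x"
  proof (cases "\<alpha> > 0")
    case False
    then show ?thesis using ux by simp
  next
    case True
    then have cl: "closed {y. v y \<ge> \<alpha>}" using v less ux
      by (auto simp: F1_USC_def alpha_cut_def dest!: bspec[of _ _ \<alpha>])
    have "(x, u x) \<in> endograph u" using ux by (auto simp: endograph_def)
    moreover have "Hend u v \<le> 0" using 0 by simp
    ultimately have near: "\<exists>b\<in>endograph v. dbar (x, u x) b < e" if "e > 0" for e
      using that unfolding Hend_le_iff[OF fz] by fastforce
    have "x \<in> closure {y. v y \<ge> \<alpha>}"
      unfolding closure_approachable
    proof (intro allI impI)
      fix e :: real assume "e > 0"
      then obtain b where b: "b \<in> endograph v" "dbar (x, u x) b < min e (u x - \<alpha>)"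
        using near[of "min e (u x - \<alpha>)"] less by auto
      have "\<bar>u x - snd b\<bar> < u x - \<alpha>" "dist x (fst b) < e"
        using b(2) zero_le_dist[of x "fst b"] abs_ge_zero[of "u x - snd b"]
        unfolding dbar_def fst_conv snd_conv by linarith+
      then show "\<exists>y\<in>{y. v y \<ge> \<alpha>}. dist y x < e" using b(1)
        by (intro bexI[of _ "fst b"]) (auto simp: endograph_def dist_commute)
    qed
    then show ?thesis using cl by simp
  qed
qed

lemma Metric_space_F1_USC: "Metric_space F1_USC Hend"
proof
  fix u v w :: "'a \<Rightarrow> real"
  show "0 \<le> Hend u v" by (rule Hend_nonneg)
  show "Hend u v = Hend v u" by (rule Hend_commute)
  assume u: "u \<in> F1_USC" and v: "v \<in> F1_USC"
  then have fz: "u \<in> fuzzy_sets" "v \<in> fuzzy_sets" by (auto simp: F1_USC_def)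
  show "Hend u v = 0 \<longleftrightarrow> u = v"
  proof
    assume "Hend u v = 0"
    then show "u = v" using Hend_zero_le[OF u v] Hend_zero_le[OF v u]
      by (auto simp: Hend_commute intro!: ext antisym)
  next
    assume "u = v"
    then have "Hend u v \<le> 0" unfolding Hend_le_iff[OF fz]
      by (auto simp: dbar_def intro!: bexI)
    then show "Hend u v = 0" using Hend_nonneg[of u v] by simp
  qed
  assume "w \<in> F1_USC"
  then show "Hend u w \<le> Hend u v + Hend v w"
    using fz by (intro Hend_triangle) (auto simp: F1_USC_def)
qed

lemma Metric_space_F1_USCG: "Metric_space F1_USCG Hend"
  using Metric_space_F1_USC by (rule Metric_space.subspace) (auto simp: F1_USCG_def)

end

theory Submission
  imports Defs
begin

text \<open>
  Only (ii) \<open>\<Longrightarrow>\<close> (i) and (i) \<open>\<Longrightarrow>\<close> (iii) need an argument: a compact set is its own closure, which gives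
  (iii) \<open>\<Longrightarrow>\<close> (ii), and compact sets are closed in a metric space.

  Suppose that every \<open>level_union U \<alpha>\<close> is relatively compact. All endographs contain the base
  \<open>X \<times> {0}\<close>, so a point of height at most \<open>e\<close> is within \<open>e\<close> of every endograph. The
  distance of two members of \<open>U\<close> up to an error of order \<open>e\<close> is therefore decided over
  \<open>level_union U e\<close>, which finitely many \<open>e\<close>-balls cover. Recording which of the finitely many
  cells of the resulting grid are met by an endograph determines the fuzzy set up to \<open>3 * e\<close>;
  hence \<open>U\<close> is totally bounded (\<open>mtotally_bounded_Hend\<close>) and every sequence in \<open>U\<close> has a
  Cauchy subsequence.

  The space \<open>X\<close> need not be complete, so the limit of a Cauchy sequence must be produced by hand.
  The candidate is the function whose hypograph is the Kuratowski upper limit of the hypographs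
  (\<open>hypo_limsup\<close>). Compactness of the closures of the level unions supplies the cluster points
  that make its cuts nonempty and compact (\<open>hypo_limsup_in_F1_USCG\<close>) and that make it the limit
  for the endograph metric (\<open>Hend_hypo_limsup_le\<close>). As \<open>U\<close> is closed, the limit lies in
  \<open>U\<close>, and \<open>U\<close> is sequentially compact.

  Conversely, let \<open>U\<close> be compact and let \<open>x n\<close> lie in the \<open>\<alpha>\<close>-cut of some member
  \<open>\<sigma> n\<close> of \<open>U\<close>. Along a subsequence \<open>\<sigma> n\<close> tends to some \<open>u\<close> in \<open>U\<close>, so
  \<open>x n\<close> is shadowed by points \<open>y n\<close> with \<open>u (y n)\<close> eventually above every
  \<open>\<beta> < \<alpha>\<close>. These lie in a compact cut of \<open>u\<close>, and since the cuts are closed, their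
  cluster points belong to the \<open>\<alpha>\<close>-cut of \<open>u\<close>
  (\<open>compact_level_union_if_compactin_Hend\<close>).
\<close>

section \<open>Levels and endograph distance\<close>

lemma F1_USCG_fuzzy: "u \<in> F1_USCG \<Longrightarrow> u \<in> fuzzy_sets"
  by (simp add: F1_USCG_def F1_USC_def)

lemma fuzzy_bounds: "u \<in> fuzzy_sets \<Longrightarrow> 0 \<le> u x \<and> u x \<le> 1"
  by (simp add: fuzzy_sets_def)

lemma F1_USCG_compact_level:
  assumes "u \<in> F1_USCG" "0 < \<alpha>" "\<alpha> \<le> 1"
  shows "compact {x. \<alpha> \<le> u x}"
  using assms by (auto simp: F1_USCG_def alpha_cut_def dest!: bspec[of _ _ \<alpha>])

lemma F1_USCG_attains_1:
  assumes "u \<in> F1_USCG"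
  obtains x where "1 \<le> u x"
  using assms by (auto simp: F1_USCG_def alpha_cut_def dest!: bspec[of _ _ 1])

lemma level_union_iff:
  "\<alpha> > 0 \<Longrightarrow> x \<in> level_union U \<alpha> \<longleftrightarrow> (\<exists>u\<in>U. \<alpha> \<le> u x)"
  by (simp add: level_union_def alpha_cut_def)

text \<open>
  With a strict bound the point of the second endograph is attained, which spares the
  \<open>\<epsilon>\<close>-slack that the infimum in the Hausdorff distance leaves.
\<close>

lemma Hend_less_near:
  assumes "u \<in> fuzzy_sets" "v \<in> fuzzy_sets" "Hend u v < r" "0 \<le> t" "t \<le> u x"
  obtains y s where "0 \<le> s" "s \<le> v y" "dist x y + \<bar>t - s\<bar> < r"
proof -
  have "(x, t) \<in> endograph u"
    using assms fuzzy_bounds[OF assms(1), of x] by (auto simp: endograph_def)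
  moreover have "\<forall>a\<in>endograph u. \<forall>e>0. \<exists>b\<in>endograph v. dbar a b < Hend u v + e"
    using Hend_le_iff[OF assms(1,2), of "Hend u v"] by simp
  moreover have "r - Hend u v > 0" using assms(3) by simp
  ultimately obtain b where "b \<in> endograph v" "dbar (x, t) b < Hend u v + (r - Hend u v)"
    by blast
  then show thesis
    using that[of "snd b" "fst b"] by (auto simp: endograph_def dbar_def)
qed

lemma Hend_leI:
  assumes "u \<in> fuzzy_sets" "v \<in> fuzzy_sets"
    and uv: "\<And>x t. \<lbrakk>0 \<le> t; t \<le> 1; t \<le> u x\<rbrakk> \<Longrightarrow> \<exists>y s. 0 \<le> s \<and> s \<le> v y \<and> dist x y + \<bar>t - s\<bar> \<le> r"
    and vu: "\<And>x t. \<lbrakk>0 \<le> t; t \<le> 1; t \<le> v x\<rbrakk> \<Longrightarrow> \<exists>y s. 0 \<le> s \<and> s \<le> u y \<and> dist x y + \<bar>t - s\<bar> \<le> r"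
  shows "Hend u v \<le> r"
proof -
  have *: "\<exists>b\<in>endograph q. dbar a b < r + e"
    if q: "q \<in> fuzzy_sets" and a: "a \<in> endograph p" and e: "e > 0"
      and near: "\<And>x t. \<lbrakk>0 \<le> t; t \<le> 1; t \<le> p x\<rbrakk> \<Longrightarrow> \<exists>y s. 0 \<le> s \<and> s \<le> q y \<and> dist x y + \<bar>t - s\<bar> \<le> r"
    for p q :: "'a \<Rightarrow> real" and a e
  proof -
    obtain y s where ys: "0 \<le> s" "s \<le> q y" "dist (fst a) y + \<bar>snd a - s\<bar> \<le> r"
      using near[of "snd a" "fst a"] a by (auto simp: endograph_def)
    then show ?thesis
      using e fuzzy_bounds[OF q, of y]
      by (intro bexI[of _ "(y, s)"]) (auto simp: endograph_def dbar_def)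
  qed
  show ?thesis
    unfolding Hend_le_iff[OF assms(1,2)]
    using *[OF assms(2) _ _ uv] *[OF assms(1) _ _ vu] by blast
qed

section \<open>Upper limits of sequences of fuzzy sets\<close>

text \<open>
  These are the heights \<open>t\<close> for which \<open>(x, t)\<close> is a cluster point of the hypographs of the
  \<open>\<sigma> n\<close>. Asking for arbitrarily large indices rather than for all large ones lets cluster points
  in compact sets be used directly; along a Cauchy sequence both readings give the same set.
\<close>

definition hypo_limsup_levels :: "(nat \<Rightarrow> 'a::metric_space \<Rightarrow> real) \<Rightarrow> 'a \<Rightarrow> real set" where
  "hypo_limsup_levels \<sigma> x =
    {t \<in> {0..1}. \<forall>e>0. \<exists>\<^sub>F n in sequentially. \<exists>y. dist x y < e \<and> t - e < \<sigma> n y}"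

definition hypo_limsup :: "(nat \<Rightarrow> 'a::metric_space \<Rightarrow> real) \<Rightarrow> 'a \<Rightarrow> real" where
  "hypo_limsup \<sigma> x = Sup (hypo_limsup_levels \<sigma> x)"

lemma zero_in_hypo_limsup_levels:
  assumes "range \<sigma> \<subseteq> fuzzy_sets"
  shows "0 \<in> hypo_limsup_levels \<sigma> x"
proof -
  have "\<exists>y. dist x y < e \<and> 0 - e < \<sigma> n y" if "e > 0" for e n
  proof -
    have "0 \<le> \<sigma> n x" using assms fuzzy_bounds by (metis rangeI subsetD)
    then show ?thesis using that by (intro exI[of _ x]) auto
  qed
  then show ?thesis
    by (auto simp: hypo_limsup_levels_def intro!: frequently_eventually_frequently always_eventually)
qed

text \<open>
  The supremum in \<open>hypo_limsup\<close> is attained, because the condition on a height passes to limits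
  of heights. Hence the cuts of the upper limit are described by cluster points alone.
\<close>

lemma hypo_limsup_ge_iff:
  assumes "range \<sigma> \<subseteq> fuzzy_sets" "t \<in> {0..1}"
  shows "t \<le> hypo_limsup \<sigma> x \<longleftrightarrow>
    (\<forall>e>0. \<exists>\<^sub>F n in sequentially. \<exists>y. dist x y < e \<and> t - e < \<sigma> n y)"
proof
  assume t: "t \<le> hypo_limsup \<sigma> x"
  show "\<forall>e>0. \<exists>\<^sub>F n in sequentially. \<exists>y. dist x y < e \<and> t - e < \<sigma> n y"
  proof (intro allI impI)
    fix e :: real assume e: "e > 0"
    then have "t - e/2 < Sup (hypo_limsup_levels \<sigma> x)"
      using t by (simp add: hypo_limsup_def)
    then obtain s where s: "s \<in> hypo_limsup_levels \<sigma> x" "t - e/2 < s"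
      using less_cSupD[OF _ \<open>t - e/2 < _\<close>] zero_in_hypo_limsup_levels[where x = x, OF assms(1)] by blast
    then have "\<exists>\<^sub>F n in sequentially. \<exists>y. dist x y < e/2 \<and> s - e/2 < \<sigma> n y"
      using half_gt_zero[OF e] unfolding hypo_limsup_levels_def by blast
    then show "\<exists>\<^sub>F n in sequentially. \<exists>y. dist x y < e \<and> t - e < \<sigma> n y"
    proof (rule frequently_elim1)
      fix n assume "\<exists>y. dist x y < e/2 \<and> s - e/2 < \<sigma> n y"
      then obtain y where "dist x y < e/2" "s - e/2 < \<sigma> n y" by blast
      then have "dist x y < e \<and> t - e < \<sigma> n y" using s(2) e by linarith
      then show "\<exists>y. dist x y < e \<and> t - e < \<sigma> n y" by blast
    qed
  qed
next
  assume "\<forall>e>0. \<exists>\<^sub>F n in sequentially. \<exists>y. dist x y < e \<and> t - e < \<sigma> n y"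
  then have "t \<in> hypo_limsup_levels \<sigma> x"
    using assms(2) by (simp add: hypo_limsup_levels_def)
  moreover have "bdd_above (hypo_limsup_levels \<sigma> x)"
    by (rule bdd_aboveI[of _ 1]) (simp add: hypo_limsup_levels_def)
  ultimately show "t \<le> hypo_limsup \<sigma> x"
    unfolding hypo_limsup_def by (rule cSup_upper)
qed

lemma hypo_limsup_fuzzy:
  assumes "range \<sigma> \<subseteq> fuzzy_sets"
  shows "hypo_limsup \<sigma> \<in> fuzzy_sets"
proof -
  have "0 \<le> hypo_limsup \<sigma> x \<and> hypo_limsup \<sigma> x \<le> 1" for x
  proof
    show "0 \<le> hypo_limsup \<sigma> x"
      unfolding hypo_limsup_def
      by (rule cSup_upper[OF zero_in_hypo_limsup_levels[OF assms]])
        (rule bdd_aboveI[of _ 1], simp add: hypo_limsup_levels_def)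
    show "hypo_limsup \<sigma> x \<le> 1"
      unfolding hypo_limsup_def
      using zero_in_hypo_limsup_levels[OF assms, of x]
      by (intro cSup_least) (blast, simp add: hypo_limsup_levels_def)
  qed
  then show ?thesis by (simp add: fuzzy_sets_def)
qed

lemma closed_hypo_limsup_level:
  assumes "range \<sigma> \<subseteq> fuzzy_sets" "t \<in> {0..1}"
  shows "closed {x. t \<le> hypo_limsup \<sigma> x}"
proof -
  have "t \<le> hypo_limsup \<sigma> x" if x: "x \<in> closure {x. t \<le> hypo_limsup \<sigma> x}" for x
    unfolding hypo_limsup_ge_iff[OF assms]
  proof (intro allI impI)
    fix e :: real assume e: "e > 0"
    then obtain z where z: "t \<le> hypo_limsup \<sigma> z" "dist z x < e/2"
      using x half_gt_zero[OF e] unfolding closure_approachable by blast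
    then have "\<exists>\<^sub>F n in sequentially. \<exists>y. dist z y < e/2 \<and> t - e/2 < \<sigma> n y"
      using half_gt_zero[OF e] hypo_limsup_ge_iff[where x = z, OF assms] by blast
    then show "\<exists>\<^sub>F n in sequentially. \<exists>y. dist x y < e \<and> t - e < \<sigma> n y"
    proof (rule frequently_elim1)
      fix n assume "\<exists>y. dist z y < e/2 \<and> t - e/2 < \<sigma> n y"
      then obtain y where y: "dist z y < e/2" "t - e/2 < \<sigma> n y" by blast
      have "dist x y \<le> dist z x + dist z y" by (metis dist_commute dist_triangle)
      then have "dist x y < e \<and> t - e < \<sigma> n y" using y z e by linarith
      then show "\<exists>y. dist x y < e \<and> t - e < \<sigma> n y" by blast
    qed
  qed
  then show ?thesis
    by (metis (no_types, lifting) closure_subset_eq mem_Collect_eq subsetI)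
qed

text \<open>
  The source of all points at which the upper limit is large: a choice of points of \<open>K\<close> at which the
  \<open>\<sigma> n\<close> are at least \<open>t\<close> has a cluster point in \<open>K\<close>.
\<close>

lemma hypo_limsup_level_in_compact:
  assumes "range \<sigma> \<subseteq> fuzzy_sets" "t \<in> {0..1}" "compact K"
    and meets: "\<And>n. n \<ge> N \<Longrightarrow> \<exists>y\<in>K. t \<le> \<sigma> n y"
  obtains x where "x \<in> K" "t \<le> hypo_limsup \<sigma> x"
proof -
  obtain y where y: "\<And>n. y n \<in> K" "\<And>n. t \<le> \<sigma> (n + N) (y n)"
    using meets[of "_ + N"] by (metis le_add2)
  obtain x r where x: "x \<in> K" "strict_mono r" "(y \<circ> r) \<longlonglongrightarrow> x"
    using assms(3) y(1) unfolding compact_def by meson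
  have "t \<le> hypo_limsup \<sigma> x"
    unfolding hypo_limsup_ge_iff[OF assms(1,2)] frequently_sequentially
  proof (intro allI impI)
    fix e :: real and m :: nat assume e: "e > 0"
    then obtain k0 where k0: "\<And>k. k \<ge> k0 \<Longrightarrow> dist (y (r k)) x < e"
      using x(3) by (auto simp: lim_sequentially)
    define k where "k = max k0 m"
    have "m \<le> r k + N" using seq_suble[OF x(2), of k] by (simp add: k_def)
    moreover have "dist x (y (r k)) < e" using k0[of k] by (simp add: k_def dist_commute)
    moreover have "t - e < \<sigma> (r k + N) (y (r k))" using y(2)[of "r k"] e by linarith
    ultimately show "\<exists>n\<ge>m. \<exists>y. dist x y < e \<and> t - e < \<sigma> n y" by blast
  qed
  then show thesis using x(1) that by blast
qed

section \<open>Convergence of Cauchy sequences\<close>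

lemma compact_level_closure:
  assumes "\<forall>\<alpha>\<in>{0<..1}. relatively_compact (level_union U \<alpha>)" "0 < \<alpha>" "\<alpha> \<le> 1"
  shows "compact (closure (level_union U \<alpha>))"
  using assms by (simp add: relatively_compact_def)

text \<open>
  The upper limit reaches the height 1 because all \<open>\<sigma> n\<close> do so inside one compact set. Its
  \<open>\<alpha>\<close>-cut consists of limits of points where some \<open>\<sigma> n\<close> is at least \<open>\<alpha>/2\<close>; the loss
  of height is harmless, since the closure of the level union at \<open>\<alpha>/2\<close> is compact as well.
\<close>

lemma hypo_limsup_in_F1_USCG:
  assumes U: "U \<subseteq> F1_USCG" and \<sigma>: "range \<sigma> \<subseteq> U"
    and rc: "\<forall>\<alpha>\<in>{0<..1}. relatively_compact (level_union U \<alpha>)"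
  shows "hypo_limsup \<sigma> \<in> F1_USCG"
proof -
  let ?u = "hypo_limsup \<sigma>"
  have fz: "range \<sigma> \<subseteq> fuzzy_sets" using U \<sigma> F1_USCG_fuzzy by blast
  then have fzn: "\<sigma> k \<in> fuzzy_sets" for k by blast
  have \<sigma>U: "\<sigma> k \<in> U" for k using \<sigma> by blast
  have "\<exists>y\<in>closure (level_union U 1). 1 \<le> \<sigma> n y" for n
    using F1_USCG_attains_1[of "\<sigma> n"] U \<sigma>U[of n] closure_subset[of "level_union U 1"]
    by (metis level_union_iff subsetD zero_less_one)
  then obtain z where z: "1 \<le> ?u z"
    using hypo_limsup_level_in_compact[where t = 1 and N = 0, OF fz _ compact_level_closure[where \<alpha> = 1, OF rc]] by auto
  have compact_level: "compact {x. \<alpha> \<le> ?u x}" if \<alpha>: "\<alpha> \<in> {0<..1}" for \<alpha>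
  proof -
    have "{x. \<alpha> \<le> ?u x} \<subseteq> closure (level_union U (\<alpha>/2))"
    proof
      fix x assume "x \<in> {x. \<alpha> \<le> ?u x}"
      then have fr: "\<exists>\<^sub>F n in sequentially. \<exists>y. dist x y < e \<and> \<alpha> - e < \<sigma> n y" if "e > 0" for e
        using that hypo_limsup_ge_iff[where t = \<alpha> and x = x, OF fz] \<alpha> by simp
      show "x \<in> closure (level_union U (\<alpha>/2))"
        unfolding closure_approachable
      proof (intro allI impI)
        fix e :: real assume "e > 0"
        then have "min e (\<alpha>/2) > 0" using \<alpha> by simp
        then obtain n y where "dist x y < min e (\<alpha>/2)" "\<alpha> - min e (\<alpha>/2) < \<sigma> n y"
          using fr frequently_ex by blast
        then have "dist y x < e" "\<alpha>/2 \<le> \<sigma> n y" by (auto simp: dist_commute)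
        then show "\<exists>y\<in>level_union U (\<alpha>/2). dist y x < e"
          using \<sigma>U \<alpha> level_union_iff[of "\<alpha>/2" y U] by auto
      qed
    qed
    moreover have "closed {x. \<alpha> \<le> ?u x}" using \<alpha> by (intro closed_hypo_limsup_level fz) auto
    ultimately show ?thesis
      using compact_level_closure[where \<alpha> = "\<alpha>/2", OF rc] \<alpha>
      by (metis (no_types, lifting) closed_Int_compact greaterThanAtMost_iff half_gt_zero
          inf.absorb_iff1 field_sum_of_halves less_add_same_cancel2 less_eq_real_def order_trans)
  qed
  have "{x. \<alpha> \<le> ?u x} \<noteq> {}" if "\<alpha> \<le> 1" for \<alpha> using z that order_trans by blast
  moreover have "\<exists>x. 0 < ?u x" using z by (intro exI[of _ z]) simp
  ultimately show ?thesis
    using compact_level hypo_limsup_fuzzy[OF fz]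
    by (auto simp: F1_USCG_def F1_USC_def alpha_cut_def intro!: compact_imp_closed)
qed

text \<open>
  From \<open>\<sigma> n\<close> to the limit: a point \<open>(x, t)\<close> with \<open>t > e\<close> has, in every later endograph, a
  companion of height at least \<open>t - e\<close> over the ball of radius \<open>e\<close> about \<open>x\<close>. The companions
  lie over a compact set, so they cluster. From the limit to \<open>\<sigma> n\<close>: a point of the limit is close
  to the endograph of some later \<open>\<sigma> m\<close>, and this one is close to that of \<open>\<sigma> n\<close>.
\<close>

lemma Hend_hypo_limsup_le:
  assumes U: "U \<subseteq> F1_USCG" and \<sigma>: "range \<sigma> \<subseteq> U"
    and rc: "\<forall>\<alpha>\<in>{0<..1}. relatively_compact (level_union U \<alpha>)"
    and e: "e > 0" and N: "\<And>m. m \<ge> N \<Longrightarrow> Hend (\<sigma> n) (\<sigma> m) < e"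
  shows "Hend (\<sigma> n) (hypo_limsup \<sigma>) \<le> 3 * e"
proof -
  let ?u = "hypo_limsup \<sigma>"
  have fz: "range \<sigma> \<subseteq> fuzzy_sets" using U \<sigma> F1_USCG_fuzzy by blast
  then have fzn: "\<sigma> k \<in> fuzzy_sets" for k by blast
  have \<sigma>U: "\<sigma> k \<in> U" for k using \<sigma> by blast
  have ufz: "?u \<in> fuzzy_sets" by (rule hypo_limsup_fuzzy[OF fz])
  show ?thesis
  proof (rule Hend_leI[OF fzn ufz])
    fix x t assume t: "0 \<le> t" "t \<le> 1" "t \<le> \<sigma> n x"
    show "\<exists>y s. 0 \<le> s \<and> s \<le> ?u y \<and> dist x y + \<bar>t - s\<bar> \<le> 3 * e"
    proof (cases "t \<le> e")
      case True
      then show ?thesis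
        using t e fuzzy_bounds[OF ufz, of x] by (intro exI[of _ x] exI[of _ 0]) auto
    next
      case False
      \<comment> \<open>the loss in height caused by moving to a later endograph is less than \<open>e\<close>\<close>
      define \<alpha> where "\<alpha> = t - e"
      have \<alpha>: "0 < \<alpha>" "\<alpha> \<le> 1" using False t e by (auto simp: \<alpha>_def)
      let ?K = "cball x e \<inter> closure (level_union U \<alpha>)"
      have "\<exists>y\<in>?K. \<alpha> \<le> \<sigma> m y" if m: "m \<ge> N" for m
      proof -
        obtain y s where ys: "0 \<le> s" "s \<le> \<sigma> m y" "dist x y + \<bar>t - s\<bar> < e"
          using Hend_less_near[OF fzn fzn N[OF m] t(1,3)] .
        have "\<alpha> \<le> \<sigma> m y" using ys zero_le_dist[of x y] unfolding \<alpha>_def by linarith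
        moreover have "dist x y \<le> e" using ys(3) by linarith
        ultimately show ?thesis
          using \<sigma>U[of m] level_union_iff[OF \<alpha>(1), of y U] closure_subset[of "level_union U \<alpha>"]
          by (intro bexI[of _ y]) auto
      qed
      moreover have "compact ?K"
        by (intro closed_Int_compact closed_cball compact_level_closure[OF rc] \<alpha>)
      ultimately obtain y where "y \<in> ?K" "\<alpha> \<le> ?u y"
        using hypo_limsup_level_in_compact[where t = \<alpha> and K = ?K and N = N, OF fz] \<alpha> by auto
      then show ?thesis
        using \<alpha> e by (intro exI[of _ y] exI[of _ \<alpha>]) (auto simp: \<alpha>_def)
    qed
  next
    fix x t assume t: "0 \<le> t" "t \<le> 1" "t \<le> ?u x"
    then have "\<exists>\<^sub>F m in sequentially. \<exists>y. dist x y < e \<and> t - e < \<sigma> m y"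
      using hypo_limsup_ge_iff[where t = t and x = x, OF fz] e by simp
    then obtain m y where m: "m \<ge> N" "dist x y < e" "t - e < \<sigma> m y"
      unfolding frequently_sequentially by blast
    \<comment> \<open>heights in an endograph are nonnegative, so \<open>t - e\<close> has to be cut off at 0\<close>
    define s where "s = max 0 (t - e)"
    have "0 \<le> s" "s \<le> \<sigma> m y" using m fuzzy_bounds[OF fzn, of m y] by (auto simp: s_def)
    moreover have "Hend (\<sigma> m) (\<sigma> n) < e" using N[OF m(1)] by (simp add: Hend_commute)
    ultimately obtain z q where zq: "0 \<le> q" "q \<le> \<sigma> n z" "dist y z + \<bar>s - q\<bar> < e"
      using Hend_less_near[OF fzn fzn] by blast
    have "\<bar>t - s\<bar> \<le> e" using t e by (auto simp: s_def)
    then have "dist x z + \<bar>t - q\<bar> \<le> 3 * e"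
      using dist_triangle[of x z y] zq(3) m(2) by linarith
    then show "\<exists>y s. 0 \<le> s \<and> s \<le> \<sigma> n y \<and> dist x y + \<bar>t - s\<bar> \<le> 3 * e"
      using zq by blast
  qed
qed

section \<open>Total boundedness\<close>

text \<open>
  Round the height of a point above \<open>e\<close> down to a multiple of \<open>e\<close>, and replace its base point
  by the centre of a ball of the cover. If the other fuzzy set reaches the rounded height over the same
  ball, then it has an endograph point at distance less than \<open>2 * e\<close> horizontally and \<open>e\<close>
  vertically.
\<close>

lemma Hend_le_if_same_grid_cells:
  assumes uv: "u \<in> fuzzy_sets" "v \<in> fuzzy_sets" and e: "0 < e"
    and cover: "\<And>w y. \<lbrakk>w \<in> {u, v}; e \<le> w y\<rbrakk> \<Longrightarrow> \<exists>c\<in>F. dist c y < e"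
    and same: "\<And>c k. \<lbrakk>c \<in> F; real k * e \<le> 1\<rbrakk> \<Longrightarrow>
      (\<exists>y. dist c y < e \<and> real k * e \<le> u y) \<longleftrightarrow> (\<exists>y. dist c y < e \<and> real k * e \<le> v y)"
  shows "Hend u v \<le> 3 * e"
proof -
  have *: "\<exists>y s. 0 \<le> s \<and> s \<le> q y \<and> dist x y + \<bar>t - s\<bar> \<le> 3 * e"
    if q: "q \<in> fuzzy_sets" and t: "0 \<le> t" "t \<le> 1" "t \<le> p x"
      and cover: "\<And>y. e \<le> p y \<Longrightarrow> \<exists>c\<in>F. dist c y < e"
      and same: "\<And>c k. \<lbrakk>c \<in> F; real k * e \<le> 1; \<exists>y. dist c y < e \<and> real k * e \<le> p y\<rbrakk> \<Longrightarrow>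
         \<exists>y. dist c y < e \<and> real k * e \<le> q y"
    for p q x t
  proof (cases "t \<le> e")
    case True
    then show ?thesis
      using t e fuzzy_bounds[OF q, of x] by (intro exI[of _ x] exI[of _ 0]) auto
  next
    case False
    then obtain c where c: "c \<in> F" "dist c x < e" using cover[of x] t by force
    define k where "k = nat \<lfloor>t / e\<rfloor>"
    have rk: "real k = of_int \<lfloor>t / e\<rfloor>" using t e by (simp add: k_def)
    have "real k \<le> t / e" "t / e < real k + 1" unfolding rk by linarith+
    then have k: "real k * e \<le> t" "t < real k * e + e" using e by (auto simp: field_simps)
    have "\<exists>y. dist c y < e \<and> real k * e \<le> p y" using c k t by force
    with same[OF c(1), of k] k t obtain y where y: "dist c y < e" "real k * e \<le> q y" by force
    have "dist x y \<le> dist c x + dist c y" by (metis dist_commute dist_triangle)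
    then have "dist x y + \<bar>t - real k * e\<bar> \<le> 3 * e" using k c y by linarith
    then show ?thesis using y e by (intro exI[of _ y] exI[of _ "real k * e"]) auto
  qed
  show ?thesis
  proof (rule Hend_leI[OF uv])
    show "\<exists>y s. 0 \<le> s \<and> s \<le> v y \<and> dist x y + \<bar>t - s\<bar> \<le> 3 * e"
      if "0 \<le> t" "t \<le> 1" "t \<le> u x" for x t
      by (rule *[where p = u, OF uv(2) that]) (use cover same in blast)+
    show "\<exists>y s. 0 \<le> s \<and> s \<le> u y \<and> dist x y + \<bar>t - s\<bar> \<le> 3 * e"
      if "0 \<le> t" "t \<le> 1" "t \<le> v x" for x t
      by (rule *[where p = v, OF uv(1) that]) (use cover same in blast)+
  qed
qed

lemma mtotally_bounded_Hend:
  assumes U: "U \<subseteq> F1_USCG"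
    and rc: "\<forall>\<alpha>\<in>{0<..1}. relatively_compact (level_union U \<alpha>)"
  shows "Metric_space.mtotally_bounded F1_USCG Hend U"
proof -
  interpret Metric_space F1_USCG Hend by (rule Metric_space_F1_USCG)
  have "\<exists>K. finite K \<and> K \<subseteq> U \<and> U \<subseteq> (\<Union>u\<in>K. mball u \<epsilon>)" if "\<epsilon> > 0" for \<epsilon>
  proof -
    \<comment> \<open>\<open>e \<le> 1\<close> since compactness of the level unions is given up to height 1 only\<close>
    define e where "e = min 1 (\<epsilon> / 4)"
    have e: "0 < e" "e \<le> 1" "3 * e < \<epsilon>" using that by (auto simp: e_def min_def)
    obtain F where F: "finite F" "closure (level_union U e) \<subseteq> (\<Union>c\<in>F. ball c e)"
      using compact_level_closure[OF rc e(1,2)] e(1) unfolding compact_eq_totally_bounded by meson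
    define G where "G = F \<times> {k. real k * e \<le> 1}"
    have "{k. real k * e \<le> 1} \<subseteq> {..nat \<lfloor>1 / e\<rfloor>}"
      using e by (auto simp: field_simps le_nat_floor)
    then have "finite G" using F(1) by (auto simp: G_def intro: finite_subset)
    \<comment> \<open>the cells of the grid that \<open>u\<close> reaches; one representative of each value of \<open>S\<close> is a net\<close>
    define S where "S u = {(c, k) \<in> G. \<exists>y. dist c y < e \<and> real k * e \<le> u y}" for u
    have "S ` U \<subseteq> Pow G" by (auto simp: S_def)
    then have "finite (S ` U)" using \<open>finite G\<close> by (meson finite_Pow_iff finite_subset)
    then obtain K where K: "K \<subseteq> U" "finite K" "S ` U = S ` K"
      using finite_subset_image[of "S ` U" S U] by auto
    have "U \<subseteq> (\<Union>u\<in>K. mball u \<epsilon>)"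
    proof
      fix v assume v: "v \<in> U"
      then obtain u where u: "u \<in> K" "S u = S v" using K(3) by (metis imageE imageI)
      have uU: "u \<in> U" using u K by auto
      have "Hend u v \<le> 3 * e"
      proof (rule Hend_le_if_same_grid_cells[where F = F])
        show "\<exists>c\<in>F. dist c y < e" if "w \<in> {u, v}" "e \<le> w y" for w y
        proof -
          have "y \<in> closure (level_union U e)"
            using that uU v level_union_iff[OF e(1), of y U] closure_subset[of "level_union U e"]
            by blast
          with F(2) have "y \<in> (\<Union>c\<in>F. ball c e)" by (rule subsetD)
          then show ?thesis by simp
        qed
        show "(\<exists>y. dist c y < e \<and> real k * e \<le> u y) \<longleftrightarrow> (\<exists>y. dist c y < e \<and> real k * e \<le> v y)"
          if "c \<in> F" "real k * e \<le> 1" for c k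
        proof -
          have "(c, k) \<in> S u \<longleftrightarrow> (c, k) \<in> S v" using u(2) by simp
          then show ?thesis using that by (simp add: S_def G_def)
        qed
      qed (use U uU v e F1_USCG_fuzzy in auto)
      then have "v \<in> mball u \<epsilon>" using e U uU v by auto
      then show "v \<in> (\<Union>u\<in>K. mball u \<epsilon>)" using u by blast
    qed
    then show ?thesis using K by blast
  qed
  then show ?thesis by (simp add: mtotally_bounded_def)
qed

section \<open>Compactness in the endograph metric\<close>

lemma compactin_Hend_if_relatively_compact_levels:
  assumes U: "U \<subseteq> F1_USCG"
    and rc: "\<forall>\<alpha>\<in>{0<..1}. relatively_compact (level_union U \<alpha>)"
    and cl: "closedin (Metric_space.mtopology F1_USCG Hend) U"
  shows "compactin (Metric_space.mtopology F1_USCG Hend) U"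
proof -
  interpret Metric_space F1_USCG Hend by (rule Metric_space_F1_USCG)
  show ?thesis
    unfolding compactin_sequentially
  proof (intro conjI allI impI U)
    fix \<sigma> :: "nat \<Rightarrow> 'a \<Rightarrow> real" assume \<sigma>: "range \<sigma> \<subseteq> U"
    obtain r where r: "strict_mono r" "MCauchy (\<sigma> \<circ> r)"
      using mtotally_bounded_Hend[OF U rc] \<sigma> unfolding mtotally_bounded_sequentially by blast
    let ?\<tau> = "\<sigma> \<circ> r" and ?u = "hypo_limsup (\<sigma> \<circ> r)"
    have \<tau>: "range ?\<tau> \<subseteq> U" using \<sigma> by auto
    have u: "?u \<in> F1_USCG" by (rule hypo_limsup_in_F1_USCG[OF U \<tau> rc])
    have lim: "limitin mtopology ?\<tau> ?u sequentially"
      unfolding limit_metric_sequentially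
    proof (intro conjI allI impI u)
      fix e :: real assume "e > 0"
      then have e: "e/4 > 0" by simp
      then obtain N where "\<And>n m. \<lbrakk>n \<ge> N; m \<ge> N\<rbrakk> \<Longrightarrow> Hend (?\<tau> n) (?\<tau> m) < e/4"
        using r(2) unfolding MCauchy_def by meson
      then have "Hend (?\<tau> n) ?u \<le> 3 * (e/4)" if "n \<ge> N" for n
        using Hend_hypo_limsup_le[where N = N and n = n, OF U \<tau> rc e] that by blast
      then show "\<exists>N. \<forall>n\<ge>N. ?\<tau> n \<in> F1_USCG \<and> Hend (?\<tau> n) ?u < e"
        using \<tau> U \<open>e > 0\<close> by (intro exI[of _ N]) fastforce
    qed
    then have "?u \<in> U" using cl \<tau> unfolding metric_closedin_iff_sequentially_closed by blast
    then show "\<exists>l r. l \<in> U \<and> strict_mono r \<and> limitin mtopology (\<sigma> \<circ> r) l sequentially"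
      using r(1) lim by blast
  qed
qed

text \<open>
  Only the \<open>\<alpha>\<close>-cut of the limit \<open>u\<close> will do at the end, but the points obtained from the
  endograph distance have heights slightly below \<open>\<alpha>\<close>. So compactness is taken from the cut at
  \<open>\<alpha>/2\<close>, and the height \<open>\<alpha>\<close> is recovered at the cluster point from the closed cuts at all
  \<open>\<beta> < \<alpha>\<close>.
\<close>

lemma compact_level_union_if_compactin_Hend:
  assumes comp: "compactin (Metric_space.mtopology F1_USCG Hend) U" and \<alpha>: "0 < \<alpha>" "\<alpha> \<le> 1"
  shows "compact (level_union U \<alpha>)"
proof -
  interpret Metric_space F1_USCG Hend by (rule Metric_space_F1_USCG)
  show ?thesis
    unfolding compact_def
  proof (intro allI impI)
    fix x :: "nat \<Rightarrow> 'a" assume "\<forall>n. x n \<in> level_union U \<alpha>"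
    then obtain \<sigma> where \<sigma>: "\<And>n. \<sigma> n \<in> U" "\<And>n. \<alpha> \<le> \<sigma> n (x n)"
      unfolding level_union_iff[OF \<alpha>(1)] by metis
    have U: "U \<subseteq> F1_USCG" using comp by (simp add: compactin_sequentially)
    have fz: "\<And>v. v \<in> U \<Longrightarrow> v \<in> fuzzy_sets" using U F1_USCG_fuzzy by blast
    obtain u r where u: "u \<in> U" "strict_mono r" "limitin mtopology (\<sigma> \<circ> r) u sequentially"
      using comp \<sigma>(1) unfolding compactin_sequentially by (metis image_subsetI)
    \<comment> \<open>a null sequence strictly above the distances, as a nearby point needs a strict bound\<close>
    define \<delta> where "\<delta> n = Hend (\<sigma> (r n)) u + inverse (real (Suc n))" for n
    have less_\<delta>: "Hend (\<sigma> (r n)) u < \<delta> n" for n by (simp add: \<delta>_def)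
    have "\<exists>y. dist (x (r n)) y < \<delta> n \<and> \<alpha> - \<delta> n < u y" for n
    proof -
      obtain y s where "0 \<le> s" "s \<le> u y" "dist (x (r n)) y + \<bar>\<alpha> - s\<bar> < \<delta> n"
        using Hend_less_near[OF fz[OF \<sigma>(1)] fz[OF u(1)] less_\<delta> less_imp_le[OF \<alpha>(1)] \<sigma>(2)] .
      moreover have "0 \<le> dist (x (r n)) y" by simp
      ultimately have "dist (x (r n)) y < \<delta> n \<and> \<alpha> - \<delta> n < u y" by linarith
      then show ?thesis by blast
    qed
    then obtain y where y: "\<And>n. dist (x (r n)) (y n) < \<delta> n" "\<And>n. \<alpha> - \<delta> n < u (y n)" by metis
    have "(\<lambda>n. Hend (\<sigma> (r n)) u) \<longlonglongrightarrow> 0"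
      using u(3) Hend_nonneg
      unfolding limit_metric_sequentially lim_sequentially dist_real_def
      by (metis abs_of_nonneg comp_apply diff_zero)
    then have \<delta>: "\<delta> \<longlonglongrightarrow> 0"
      unfolding \<delta>_def
      using tendsto_add[OF _ LIMSEQ_inverse_real_of_nat] by fastforce
    then obtain N where N: "\<And>n. n \<ge> N \<Longrightarrow> \<delta> n < \<alpha>/2"
      using order_tendstoD(2)[OF \<delta>, of "\<alpha>/2"] \<alpha> by (auto simp: eventually_sequentially)
    have "\<And>n. y (n + N) \<in> {z. \<alpha>/2 \<le> u z}"
      using y(2) N by (smt (verit) field_sum_of_halves le_add2 mem_Collect_eq)
    moreover have "compact {z. \<alpha>/2 \<le> u z}" using U u(1) \<alpha> by (intro F1_USCG_compact_level) auto
    ultimately obtain l q where q: "strict_mono q" "((\<lambda>n. y (n + N)) \<circ> q) \<longlonglongrightarrow> l"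
      unfolding compact_def by meson
    define p where "p = (\<lambda>k. q k + N)"
    have p: "strict_mono p" using q(1) by (simp add: p_def strict_mono_def)
    have yl: "(\<lambda>k. y (p k)) \<longlonglongrightarrow> l" using q(2) by (simp add: p_def o_def)
    have \<delta>p: "(\<lambda>k. \<delta> (p k)) \<longlonglongrightarrow> 0" using LIMSEQ_subseq_LIMSEQ[OF \<delta> p] by (simp add: o_def)
    have xl: "(\<lambda>k. x (r (p k))) \<longlonglongrightarrow> l"
    proof -
      have "(\<lambda>k. dist (y (p k)) l) \<longlonglongrightarrow> 0"
        by (rule iffD1[OF tendsto_dist_iff yl])
      then have sum: "(\<lambda>k. \<delta> (p k) + dist (y (p k)) l) \<longlonglongrightarrow> 0"
        using tendsto_add[OF \<delta>p, of "\<lambda>k. dist (y (p k)) l" 0] by simp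
      have "dist (x (r (p k))) l \<le> dist (\<delta> (p k) + dist (y (p k)) l) 0" for k
        using dist_triangle[of "x (r (p k))" l "y (p k)"] y(1)[of "p k"]
        unfolding dist_real_def by linarith
      then show ?thesis
        by (intro metric_tendsto_imp_tendsto[OF sum] always_eventually allI)
    qed
    have "\<beta> \<le> u l" if \<beta>: "0 < \<beta>" "\<beta> < \<alpha>" for \<beta>
    proof -
      have "closed {z. \<beta> \<le> u z}"
        using U u(1) \<alpha> \<beta> by (intro compact_imp_closed F1_USCG_compact_level) auto
      moreover have "\<forall>\<^sub>F k in sequentially. \<delta> (p k) < \<alpha> - \<beta>"
        using order_tendstoD(2)[OF \<delta>p] \<beta> by simp
      then have "\<forall>\<^sub>F k in sequentially. y (p k) \<in> {z. \<beta> \<le> u z}"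
        by (rule eventually_mono) (use y(2) in \<open>smt (verit) mem_Collect_eq\<close>)
      ultimately have "l \<in> {z. \<beta> \<le> u z}"
        by (rule Lim_in_closed_set[OF _ _ trivial_limit_sequentially yl])
      then show ?thesis by simp
    qed
    then have "\<alpha> \<le> u l" using dense_le_bounded[OF \<alpha>(1)] by blast
    then have "l \<in> level_union U \<alpha>" using u(1) level_union_iff[OF \<alpha>(1)] by blast
    moreover have "strict_mono (r \<circ> p)" using u(2) p by (rule strict_mono_o)
    moreover have "(x \<circ> (r \<circ> p)) \<longlonglongrightarrow> l" using xl by (simp add: o_def)
    ultimately show "\<exists>l\<in>level_union U \<alpha>. \<exists>r. strict_mono r \<and> (x \<circ> r) \<longlonglongrightarrow> l" by blast
  qed
qed

theorem theorem7p10: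
  fixes U :: "('a::metric_space \<Rightarrow> real) set"
  assumes "U \<subseteq> F1_USCG"
  shows "(compactin (Metric_space.mtopology F1_USCG Hend) U
           \<longleftrightarrow> (\<forall>\<alpha>\<in>{0<..1}. relatively_compact (level_union U \<alpha>))
               \<and> closedin (Metric_space.mtopology F1_USCG Hend) U)
       \<and> (compactin (Metric_space.mtopology F1_USCG Hend) U
           \<longleftrightarrow> (\<forall>\<alpha>\<in>{0<..1}. compact (level_union U \<alpha>))
               \<and> closedin (Metric_space.mtopology F1_USCG Hend) U)"
proof -
  interpret Metric_space F1_USCG Hend by (rule Metric_space_F1_USCG)
  have i_iii: "(\<forall>\<alpha>\<in>{0<..1}. compact (level_union U \<alpha>)) \<and> closedin mtopology U"
    if "compactin mtopology U"
    using that compact_level_union_if_compactin_Hend[OF that]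
      compactin_imp_closedin[OF Hausdorff_space_mtopology] by auto
  have iii_ii: "relatively_compact (level_union U \<alpha>)" if "compact (level_union U \<alpha>)" for \<alpha>
    using that by (simp add: relatively_compact_def compact_imp_closed)
  have ii_i: "compactin mtopology U"
    if "\<forall>\<alpha>\<in>{0<..1}. relatively_compact (level_union U \<alpha>)" "closedin mtopology U"
    using compactin_Hend_if_relatively_compact_levels[OF assms _ that(2)] that(1) by blast
  show ?thesis using i_iii iii_ii ii_i by blast
qed

end
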